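(* Let $p\geq 5$ be a prime and let $X\subset \mathbb{Z}_{2p}^2$ be an arc. If $|X|>p+3$, then there is $f\in \mathcal{G}_{2p}$ such that $(0,0),(1,0),(0,1)\in f(X)$.
   Context: For $n\ge 2$, $\mathbb{Z}_n=\mathbb{Z}/n\mathbb{Z}$ and $\mathbb{Z}_n^2=\mathbb{Z}_n\times\mathbb{Z}_n$. A line in $\mathbb{Z}_n^2$ is the image, under coordinatewise reduction modulo $n$, of a set $\{(a+uk,\,b+vk): k\in\mathbb{Z}\}\subset\mathbb{Z}^2$, where $a,b,u,v$ are integers with $\gcd(u,v)=1$. Points of $\mathbb{Z}_n^2$ are collinear if some line in $\mathbb{Z}_n^2$ contains all of them. An arc in $\mathbb{Z}_n^2$ is a subset containing no three (distinct) collinear points. An automorphism of $\mathbb{Z}_n^2$ is a (bijective) mapping $\mathbb{Z}_n^2\to\mathbb{Z}_n^2$ which preserves arcs, i.e. maps arcs to arcs; $\mathcal{G}_n$ denotes the group of all automorphisms of $\mathbb{Z}_n^2$. *)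

theory Defs
  imports "HOL-Algebra.Bij" "HOL-Computational_Algebra.Primes"
begin

text \<open>The elements of Z/nZ are represented by their canonical representatives 0, ..., n - 1.\<close>

definition torus :: "nat \<Rightarrow> (int \<times> int) set" where
  "torus n = {0..<int n} \<times> {0..<int n}"

definition reduce :: "nat \<Rightarrow> int \<times> int \<Rightarrow> int \<times> int" where
  "reduce n = (\<lambda>(x, y). (x mod int n, y mod int n))"

definition torus_lines :: "nat \<Rightarrow> (int \<times> int) set set" where
  "torus_lines n = {reduce n ` {(a + u * k, b + v * k) | k. True} | a b u v :: int. gcd u v = 1}"

definition torus_collinear :: "nat \<Rightarrow> (int \<times> int) set \<Rightarrow> bool" where
  "torus_collinear n S \<longleftrightarrow> (\<exists>L \<in> torus_lines n. S \<subseteq> L)"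

definition arc :: "nat \<Rightarrow> (int \<times> int) set \<Rightarrow> bool" where
  "arc n X \<longleftrightarrow> X \<subseteq> torus n \<and> (\<forall>T. T \<subseteq> X \<and> card T = 3 \<longrightarrow> \<not> torus_collinear n T)"

text \<open>As usual in HOL-Algebra, a map on the torus is made unique by requiring it to be
  \<^term>\<open>undefined\<close> outside (this is part of \<^const>\<open>Bij\<close>).\<close>

definition arc_auto :: "nat \<Rightarrow> (int \<times> int \<Rightarrow> int \<times> int) set" where
  "arc_auto n = {f \<in> Bij (torus n). \<forall>A. arc n A \<longrightarrow> arc n (f ` A)}"

definition ArcAutoGroup :: "nat \<Rightarrow> (int \<times> int \<Rightarrow> int \<times> int) monoid" where
  "ArcAutoGroup n = BijGroup (torus n) \<lparr>carrier := arc_auto n\<rparr>"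

text \<open>Closure under inverses holds because a bijection of the finite torus acts injectively on the
  finite set of arcs, hence permutes it.\<close>

lemma arc_auto_subgroup: "subgroup (arc_auto n) (BijGroup (torus n))"
proof -
  interpret group "BijGroup (torus n)" by (rule group_BijGroup)
  have sub: "A \<subseteq> torus n" if "arc n A" for A
    using that by (simp add: arc_def)
  show ?thesis
  proof (rule subgroupI)
    show "arc_auto n \<subseteq> carrier (BijGroup (torus n))"
      by (auto simp: arc_auto_def BijGroup_def)
    have "(\<lambda>x\<in>torus n. x) ` A = A" if "A \<subseteq> torus n" for A
      using that by (simp add: image_def restrict_def) blast
    then have "(\<lambda>x\<in>torus n. x) \<in> arc_auto n"
      using id_Bij sub by (auto simp: arc_auto_def)
    then show "arc_auto n \<noteq> {}" by blast
  next
    fix f assume f: "f \<in> arc_auto n"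
    then have fB: "f \<in> Bij (torus n)" and bij: "bij_betw f (torus n) (torus n)"
      by (auto simp: arc_auto_def Bij_def)
    let ?g = "\<lambda>x\<in>torus n. inv_into (torus n) f x"
    have "finite (Pow (torus n))" by (simp add: torus_def)
    then have fin: "finite (Collect (arc n))"
      by (rule rev_finite_subset) (use sub in auto)
    have inj: "inj_on ((`) f) (Collect (arc n))"
      by (rule inj_onI) (use sub inj_on_image_eq_iff[OF bij_betw_imp_inj_on[OF bij]] in auto)
    have maps: "(`) f ` Collect (arc n) \<subseteq> Collect (arc n)"
      using f by (auto simp: arc_auto_def)
    have surj: "(`) f ` Collect (arc n) = Collect (arc n)"
      using endo_inj_surj[OF fin maps inj] .
    have "arc n (?g ` A)" if A: "arc n A" for A
    proof -
      obtain B where B: "arc n B" "A = f ` B" using surj A by blast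
      have "?g ` f ` B = B"
      proof -
        have "?g (f x) = x" if "x \<in> B" for x
          using that sub[OF B(1)] bij by (auto simp: bij_betw_def)
        then show ?thesis by (simp only: image_image cong: image_cong) simp
      qed
      with B show ?thesis by simp
    qed
    then have "?g \<in> arc_auto n"
      using restrict_inv_into_Bij[OF fB] by (simp add: arc_auto_def)
    then show "inv\<^bsub>BijGroup (torus n)\<^esub> f \<in> arc_auto n"
      using inv_BijGroup[OF fB] by simp
  next
    fix f g assume f: "f \<in> arc_auto n" and g: "g \<in> arc_auto n"
    then have fB: "f \<in> Bij (torus n)" and gB: "g \<in> Bij (torus n)"
      by (auto simp: arc_auto_def)
    have "compose (torus n) f g ` A = f ` g ` A" if "arc n A" for A
      unfolding image_image
      by (rule image_cong) (use sub[OF that] in \<open>auto simp: compose_def\<close>)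
    then have "compose (torus n) f g \<in> arc_auto n"
      using f g compose_Bij[OF fB gB] by (auto simp: arc_auto_def)
    then show "f \<otimes>\<^bsub>BijGroup (torus n)\<^esub> g \<in> arc_auto n"
      using fB gB by (simp add: BijGroup_def)
  qed
qed

lemma ArcAutoGroup_group: "group (ArcAutoGroup n)"
  unfolding ArcAutoGroup_def
  using subgroup.subgroup_is_group[OF arc_auto_subgroup group_BijGroup] .

end

theory Submission
  imports Defs "HOL-Number_Theory.Cong"
begin

text \<open>
  Everything is read off from the integer determinant of a triple of points (twice its signed
  area).

  A triple \<open>P, Q, R\<close> whose determinant is a unit modulo \<open>2 * p\<close> is an affine frame, so the affine
  map that carries it to \<open>(0, 0), (1, 0), (0, 1)\<close> is invertible. Affine maps carry collinear sets
  to collinear sets; applied to the inverse map, this says that the map preserves arcs. So it is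
  enough to find in \<open>X\<close> a triple with odd determinant that \<open>p\<close> does not divide
  (\<open>frame_to_standard\<close>).

  By the Chinese remainder theorem, lines modulo \<open>2 * p\<close> are products of lines modulo \<open>2\<close> and
  modulo \<open>p\<close>. Sort the points into four parity classes. Two points of the affine plane over
  the field of order 2 always lie on a line, so a triple with two members in the same class is
  collinear as soon as \<open>p\<close> divides its determinant (\<open>collinear_if_same_parity\<close>); in an arc this is
  excluded. On the other hand, three points in different classes have odd determinant. If \<open>X\<close> did
  not contain the wanted triple, then, for triples of distinct points of \<open>X\<close>, divisibility of the
  determinant by \<open>p\<close> would be equivalent to lying in three different classes.

  Such a set has at most \<open>p + 3\<close> points (\<open>card_le_if_coloured\<close>). If it has more than 8
  points, some class \<open>C\<close> has three of them. Two points outside \<open>C\<close> in different classes agree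
  modulo \<open>p\<close>, since otherwise they span a line modulo \<open>p\<close> that contains all of \<open>C\<close>. So either all
  points outside \<open>C\<close> are in one class, and the whole set is an arc modulo \<open>p\<close>, or each of the three
  other classes has at most one point, and \<open>C\<close> with one of these points is an arc modulo \<open>p\<close>. Now
  Bose's bound \<open>p + 1\<close> for arcs in the affine plane of odd order \<open>p\<close>
  (\<open>card_le_if_no_three_collinear\<close>) gives \<open>p + 1\<close> in the first case and \<open>p + 3\<close> in the second.
\<close>

section \<open>Collinearity and affine maps\<close>

text \<open>The multiples of any vector are among the multiples of a primitive one, so every arithmetic
  progression lies on a line. Progressions, unlike lines, are visibly stable under affine maps.\<close>

lemma torus_collinear_iff:
  "torus_collinear n S \<longleftrightarrow> (\<exists>a b u v. S \<subseteq> reduce n ` {(a + u * k, b + v * k) | k. True})"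
    (is "_ \<longleftrightarrow> ?rhs")
proof
  assume "torus_collinear n S"
  then show ?rhs
    unfolding torus_collinear_def torus_lines_def by blast
next
  assume ?rhs
  then obtain a b u v where S: "S \<subseteq> reduce n ` {(a + u * k, b + v * k) | k. True}"
    by blast
  obtain u' v' g where g: "gcd u' v' = 1" "u = u' * g" "v = v' * g"
  proof (cases "u = 0 \<and> v = 0")
    case True
    then show ?thesis using that[of 1 0 0] by simp
  next
    case False
    then show ?thesis using gcd_coprime_exists[of u v] that
      by (metis coprime_iff_gcd_eq_1 gcd_eq_0_iff)
  qed
  have "{(a + u * k, b + v * k) | k. True} \<subseteq> {(a + u' * k, b + v' * k) | k. True}"
    using g(2,3) by (auto simp: mult.assoc)
  with S have "S \<subseteq> reduce n ` {(a + u' * k, b + v' * k) | k. True}"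
    by blast
  moreover have "reduce n ` {(a + u' * k, b + v' * k) | k. True} \<in> torus_lines n"
    unfolding torus_lines_def mem_Collect_eq
    by (rule exI[of _ a], rule exI[of _ b], rule exI[of _ u'], rule exI[of _ v']) (simp add: g(1))
  ultimately show "torus_collinear n S"
    unfolding torus_collinear_def by (rule bexI)
qed

definition affine_map :: "nat \<Rightarrow> int \<times> int \<Rightarrow> int \<times> int \<Rightarrow> int \<times> int \<Rightarrow> int \<times> int \<Rightarrow> int \<times> int" where
  "affine_map n o1 w1 w2 = (\<lambda>(x, y).
     reduce n (fst o1 + fst w1 * x + fst w2 * y, snd o1 + snd w1 * x + snd w2 * y))"

lemma reduce_eq_iff:
  "reduce n (a, b) = reduce n (c, d) \<longleftrightarrow> [a = c] (mod int n) \<and> [b = d] (mod int n)"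
  by (simp add: reduce_def cong_def)

lemma reduce_torus: "z \<in> torus n \<Longrightarrow> reduce n z = z"
  by (auto simp: reduce_def torus_def)

lemma affine_map_in_torus: "n > 0 \<Longrightarrow> affine_map n o1 w1 w2 z \<in> torus n"
  by (auto simp: affine_map_def reduce_def torus_def split: prod.split)

lemma affine_map_reduce: "affine_map n o1 w1 w2 (reduce n z) = affine_map n o1 w1 w2 z"
proof -
  have "[x mod int n = x] (mod int n)" for x :: int
    by simp
  then show ?thesis
    by (cases z) (auto simp: affine_map_def reduce_def cong_def[symmetric]
      intro!: cong_add cong_mult)
qed

lemma torus_collinear_affine_map:
  assumes "torus_collinear n S"
  shows "torus_collinear n (affine_map n o1 w1 w2 ` S)"
proof -
  obtain a b u v where S: "S \<subseteq> reduce n ` {(a + u * k, b + v * k) | k. True}"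
    using assms torus_collinear_iff by blast
  define a' where "a' = fst o1 + fst w1 * a + fst w2 * b"
  define b' where "b' = snd o1 + snd w1 * a + snd w2 * b"
  define u' where "u' = fst w1 * u + fst w2 * v"
  define v' where "v' = snd w1 * u + snd w2 * v"
  have "affine_map n o1 w1 w2 (reduce n (a + u * k, b + v * k))
      = reduce n (a' + u' * k, b' + v' * k)" for k
    unfolding affine_map_reduce
    by (simp add: affine_map_def a'_def b'_def u'_def v'_def algebra_simps)
  with S have "affine_map n o1 w1 w2 ` S \<subseteq> reduce n ` {(a' + u' * k, b' + v' * k) | k. True}"
    by fastforce
  then show ?thesis
    unfolding torus_collinear_iff by blast
qed

text \<open>Arcs are defined by forbidding collinear triples, so preserving arcs needs collinearity to
  pass from the image to the source: it is the inverse that has to be affine.\<close>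

lemma arc_image_if_affine_inverse:
  assumes f: "f ` torus n \<subseteq> torus n"
    and inv: "\<And>z. z \<in> torus n \<Longrightarrow> affine_map n o1 w1 w2 (f z) = z"
    and A: "arc n A"
  shows "arc n (f ` A)"
proof -
  have sub: "A \<subseteq> torus n" using A by (simp add: arc_def)
  have "\<not> torus_collinear n T" if T: "T \<subseteq> f ` A" "card T = 3" for T
  proof
    assume "torus_collinear n T"
    then have col: "torus_collinear n (affine_map n o1 w1 w2 ` T)"
      by (rule torus_collinear_affine_map)
    obtain B where B: "B \<subseteq> A" "T = f ` B"
      using T(1) by (rule subset_imageE)
    have inv_B: "affine_map n o1 w1 w2 (f z) = z" if "z \<in> B" for z
      using that B(1) sub inv by blast
    then have "affine_map n o1 w1 w2 ` T = B"
      unfolding B(2) image_image by (simp cong: image_cong)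
    moreover have "card B = 3"
      using T(2) card_image[OF inj_on_inverseI, of B "affine_map n o1 w1 w2" f] inv_B
      by (simp add: B(2))
    ultimately show False
      using col B(1) A by (simp add: arc_def)
  qed
  then show ?thesis
    using f sub by (auto simp: arc_def)
qed

definition twice_area :: "int \<times> int \<Rightarrow> int \<times> int \<Rightarrow> int \<times> int \<Rightarrow> int" where
  "twice_area P Q R =
     (fst Q - fst P) * (snd R - snd P) - (snd Q - snd P) * (fst R - fst P)"

lemma twice_area_rotate: "twice_area Q R P = twice_area P Q R"
  by (simp add: twice_area_def algebra_simps)

text \<open>The matrix with columns \<open>Q - P\<close> and \<open>R - P\<close> is invertible modulo \<open>n\<close>; the automorphism is the
  inverse affine map, written down by Cramer's rule.\<close>

lemma frame_to_standard:
  assumes n: "n > 1"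
    and PQR: "P \<in> torus n" "Q \<in> torus n" "R \<in> torus n"
    and unit: "coprime (twice_area P Q R) (int n)"
  shows "\<exists>f \<in> arc_auto n. f P = (0, 0) \<and> f Q = (1, 0) \<and> f R = (0, 1)"
proof -
  define a b c d where abcd: "a = fst Q - fst P" "b = fst R - fst P"
    "c = snd Q - snd P" "d = snd R - snd P"
  obtain e where "[twice_area P Q R * e = 1] (mod int n)"
    using unit cong_solve_coprime_int by blast
  then have e: "int n dvd (a * d - c * b) * e - 1"
    by (simp add: abcd twice_area_def cong_iff_dvd_diff)
  define g where "g = affine_map n P (a, c) (b, d)"
  define h where "h = affine_map n (e * (b * snd P - d * fst P), e * (c * fst P - a * snd P))
    (e * d, - e * c) (- e * b, e * a)"
  have unit_mult: "[(a * d - c * b) * e * x = x] (mod int n)" for x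
  proof -
    have "(a * d - c * b) * e * x - x = ((a * d - c * b) * e - 1) * x"
      by (simp add: algebra_simps)
    then show ?thesis
      using e by (simp add: cong_iff_dvd_diff)
  qed
  have h: "h z = reduce n (e * (d * (fst z - fst P) - b * (snd z - snd P)),
      e * (a * (snd z - snd P) - c * (fst z - fst P)))" for z
    by (cases z) (simp add: h_def affine_map_def algebra_simps)
  have gh: "g (h z) = z" if "z \<in> torus n" for z
  proof -
    have "g (h z) = reduce n (fst P + (a * d - c * b) * e * (fst z - fst P),
        snd P + (a * d - c * b) * e * (snd z - snd P))"
      unfolding g_def h affine_map_reduce by (simp add: affine_map_def algebra_simps)
    also have "\<dots> = reduce n (fst P + (fst z - fst P), snd P + (snd z - snd P))"
      unfolding reduce_eq_iff by (intro conjI cong_add cong_refl unit_mult)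
    finally show ?thesis using that by (simp add: reduce_torus)
  qed
  have hg: "h (g z) = z" if "z \<in> torus n" for z
  proof -
    obtain x y where z: "z = (x, y)" by (cases z)
    have "g z = reduce n (fst P + a * x + b * y, snd P + c * x + d * y)"
      by (simp add: g_def z affine_map_def)
    then have "h (g z) = h (fst P + a * x + b * y, snd P + c * x + d * y)"
      by (simp add: h_def affine_map_reduce)
    also have "\<dots> = reduce n ((a * d - c * b) * e * x, (a * d - c * b) * e * y)"
      unfolding h by (simp add: algebra_simps)
    also have "\<dots> = reduce n z"
      unfolding reduce_eq_iff z by (intro conjI unit_mult)
    finally show ?thesis using that by (simp add: reduce_torus)
  qed
  have into: "g z \<in> torus n" "h z \<in> torus n" for z
    using n by (simp_all add: g_def h_def affine_map_in_torus)
  define f where "f = restrict h (torus n)"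
  have "bij_betw f (torus n) (torus n)"
    by (rule bij_betw_byWitness[where f' = g]) (auto simp: f_def gh hg into)
  moreover have "arc n (f ` A)" if "arc n A" for A
    by (rule arc_image_if_affine_inverse[OF _ _ that, where ?o1.0 = P and ?w1.0 = "(a, c)"
          and ?w2.0 = "(b, d)"]) (auto simp: f_def into gh[unfolded g_def])
  ultimately have "f \<in> arc_auto n"
    by (simp add: arc_auto_def Bij_def f_def)
  moreover have "f P = (0, 0)"
    using PQR by (simp add: f_def h reduce_def)
  moreover have "f Q = (1, 0)"
  proof -
    have "h Q = reduce n ((a * d - c * b) * e * 1, 0)"
      by (simp add: h abcd[symmetric] algebra_simps)
    also have "\<dots> = reduce n (1, 0)"
      unfolding reduce_eq_iff by (intro conjI cong_refl unit_mult)
    finally show ?thesis using PQR n by (simp add: f_def reduce_def)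
  qed
  moreover have "f R = (0, 1)"
  proof -
    have "h R = reduce n (0, (a * d - c * b) * e * 1)"
      by (simp add: h abcd[symmetric] algebra_simps)
    also have "\<dots> = reduce n (0, 1)"
      unfolding reduce_eq_iff by (intro conjI cong_refl unit_mult)
    finally show ?thesis using PQR n by (simp add: f_def reduce_def)
  qed
  ultimately show ?thesis by blast
qed

section \<open>Determinants and parity classes\<close>

lemma parallel_mod_prime:
  fixes p :: int
  assumes "prime p" and det: "p dvd s * y - t * x"
  shows "\<exists>w1 w2 k l. [s = k * w1] (mod p) \<and> [t = k * w2] (mod p)
    \<and> [x = l * w1] (mod p) \<and> [y = l * w2] (mod p)"
proof -
  have scalar: "\<exists>l. [x = l * s] (mod p) \<and> [y = l * t] (mod p)"
    if s: "\<not> p dvd s" and det: "p dvd s * y - t * x" for s t x y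
  proof -
    obtain i where i: "[s * i = 1] (mod p)"
      using cong_solve_coprime_int prime_imp_coprime[OF \<open>prime p\<close> s] coprime_commute by metis
    have 1: "[i * x * s = x] (mod p)"
      using cong_mult[OF i cong_refl[of x]] by (simp add: algebra_simps)
    have "[i * (t * x) = i * (s * y)] (mod p)"
      using det by (intro cong_mult[OF cong_refl]) (simp add: cong_iff_dvd_diff dvd_diff_commute)
    also have "[i * (s * y) = y] (mod p)"
      using cong_mult[OF i cong_refl[of y]] by (simp add: algebra_simps)
    finally have "[i * x * t = y] (mod p)"
      by (simp add: algebra_simps)
    with 1 show ?thesis using cong_sym by blast
  qed
  consider "p dvd s" "p dvd t" | "\<not> p dvd s" | "\<not> p dvd t" by blast
  then show ?thesis
  proof cases
    case 1
    then have "[s = 0 * x] (mod p)" "[t = 0 * y] (mod p)" "[x = 1 * x] (mod p)" "[y = 1 * y] (mod p)"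
      by (simp_all add: cong_0_iff)
    then show ?thesis by blast
  next
    case 2
    obtain l where "[x = l * s] (mod p)" "[y = l * t] (mod p)"
      using scalar[OF 2 det] by blast
    moreover have "[s = 1 * s] (mod p)" "[t = 1 * t] (mod p)" by simp_all
    ultimately show ?thesis by blast
  next
    case 3
    have "p dvd t * x - s * y" using det by (simp add: dvd_diff_commute)
    then obtain l where "[x = l * s] (mod p)" "[y = l * t] (mod p)"
      using scalar[OF 3] by blast
    moreover have "[s = 1 * s] (mod p)" "[t = 1 * t] (mod p)" by simp_all
    ultimately show ?thesis by blast
  qed
qed

definition parity_class :: "int \<times> int \<Rightarrow> int \<times> int" where
  "parity_class P = (fst P mod 2, snd P mod 2)"

text \<open>Modulo \<open>p\<close> the triple is on a line with some direction \<open>w\<close>; modulo 2 it takes at most two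
  values and is on the line with direction \<open>R - P\<close>. The Chinese remainder theorem glues the
  directions and the parameters of the points.\<close>

lemma collinear_if_same_parity:
  assumes "prime p" and "odd p"
    and PQR: "P \<in> torus (2 * p)" "Q \<in> torus (2 * p)" "R \<in> torus (2 * p)"
    and par: "parity_class P = parity_class Q"
    and det: "int p dvd twice_area P Q R"
  shows "torus_collinear (2 * p) {P, Q, R}"
proof -
  define s t x y where stxy: "s = fst Q - fst P" "t = snd Q - snd P"
    "x = fst R - fst P" "y = snd R - snd P"
  let ?p = "int p"
  have "?p dvd s * y - t * x"
    using det by (simp add: twice_area_def stxy)
  then obtain w1 w2 k l where w: "?p dvd s - k * w1" "?p dvd t - k * w2"
      "?p dvd x - l * w1" "?p dvd y - l * w2"
    using parallel_mod_prime[of ?p s y t x] \<open>prime p\<close>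
    unfolding cong_iff_dvd_diff by (auto simp del: ex_simps)
  \<comment> \<open>For odd \<open>p\<close>, the factors \<open>p + 1\<close> and \<open>p\<close> are the idempotents of the decomposition: \<open>p + 1\<close> is
    0 modulo 2 and 1 modulo \<open>p\<close>, and \<open>p\<close> is 1 modulo 2 and 0 modulo \<open>p\<close>.\<close>
  define u where "u = (?p + 1) * w1 + ?p * x"
  define v where "v = (?p + 1) * w2 + ?p * y"
  define k' where "k' = (?p + 1) * k"
  define l' where "l' = (?p + 1) * l + ?p"
  have glue: "int (2 * p) dvd z" if "even z" "?p dvd z" for z
  proof -
    have "coprime 2 ?p" using \<open>odd p\<close> by simp
    then show ?thesis using divides_mult[OF that] by simp
  qed
  have modp: "?p dvd z - m' * (((?p + 1) * w) + ?p * r)"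
    if "?p dvd z - m * w" "?p dvd m' - m" for z m m' w r
  proof -
    have "z - m' * (((?p + 1) * w) + ?p * r)
        = (z - m * w) - (m' - m) * w - ?p * (m' * (w + r))"
      by (simp add: algebra_simps)
    then show ?thesis using that by (metis dvd_diff dvd_mult2 dvd_triv_left)
  qed
  have "?p dvd k' - k" "?p dvd l' - l"
    by (simp_all add: k'_def l'_def algebra_simps)
  note p_dvd = modp[OF w(1) this(1), of x] modp[OF w(2) this(1), of y]
    modp[OF w(3) this(2), of x] modp[OF w(4) this(2), of y]
  have st: "even s" "even t"
    using par by (auto simp: parity_class_def stxy mod_eq_dvd_iff dvd_diff_commute)
  have even: "even (s - k' * u)" "even (t - k' * v)" "even (x - l' * u)" "even (y - l' * v)"
    using st \<open>odd p\<close> by (simp_all add: u_def v_def k'_def l'_def)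
  have "int (2 * p) dvd s - k' * u" "int (2 * p) dvd t - k' * v"
    "int (2 * p) dvd x - l' * u" "int (2 * p) dvd y - l' * v"
    by (intro glue even p_dvd[folded u_def v_def])+
  then have "[fst Q = fst P + u * k'] (mod int (2 * p))" "[snd Q = snd P + v * k'] (mod int (2 * p))"
    "[fst R = fst P + u * l'] (mod int (2 * p))" "[snd R = snd P + v * l'] (mod int (2 * p))"
    unfolding cong_iff_dvd_diff by (simp_all add: stxy algebra_simps)
  then have "reduce (2 * p) (fst Q, snd Q) = reduce (2 * p) (fst P + u * k', snd P + v * k')"
    "reduce (2 * p) (fst R, snd R) = reduce (2 * p) (fst P + u * l', snd P + v * l')"
    unfolding reduce_eq_iff by blast+
  moreover have "P = reduce (2 * p) (fst P + u * 0, snd P + v * 0)"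
    using PQR(1) by (simp add: reduce_torus)
  moreover have "reduce (2 * p) (fst P + u * k, snd P + v * k)
      \<in> reduce (2 * p) ` {(fst P + u * k, snd P + v * k) | k. True}" for k
    by blast
  ultimately have "{P, Q, R} \<subseteq> reduce (2 * p) ` {(fst P + u * k, snd P + v * k) | k. True}"
    using PQR(2,3) by (metis (no_types, lifting) empty_subsetI insert_subset prod.collapse reduce_torus)
  then show ?thesis
    unfolding torus_collinear_iff by blast
qed

lemma odd_twice_area:
  assumes "parity_class P \<noteq> parity_class Q" "parity_class Q \<noteq> parity_class R"
    "parity_class P \<noteq> parity_class R"
  shows "odd (twice_area P Q R)"
proof -
  have "parity_class P = parity_class Q \<longleftrightarrow>
      (even (fst P) \<longleftrightarrow> even (fst Q)) \<and> (even (snd P) \<longleftrightarrow> even (snd Q))" for P Q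
    by (auto simp: parity_class_def mod2_eq_if)
  with assms show ?thesis
    by (auto simp: twice_area_def)
qed

section \<open>Arcs modulo an odd prime\<close>

text \<open>Bose's argument. If there were \<open>p + 2\<close> points, each of the \<open>p + 1\<close> lines through a point of
  the set would contain exactly one further point. Applied to the vertical lines, this
  divides the \<open>p + 2\<close> points into pairs, contrary to \<open>p + 2\<close> being odd.\<close>

lemma card_le_if_no_three_collinear:
  assumes p: "prime p" "odd p" and fin: "finite S"
    and gen: "\<And>P Q R. P \<in> S \<Longrightarrow> Q \<in> S \<Longrightarrow> R \<in> S \<Longrightarrow> P \<noteq> Q \<Longrightarrow> Q \<noteq> R \<Longrightarrow> P \<noteq> R
      \<Longrightarrow> \<not> int p dvd twice_area P Q R"
  shows "card S \<le> p + 1"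
proof (rule ccontr)
  let ?p = "int p"
  assume "\<not> card S \<le> p + 1"
  then have "p + 2 \<le> card S" by simp
  then obtain T where T: "T \<subseteq> S" "card T = p + 2" "finite T"
    by (rule obtain_subset_with_card_n)
  have prime: "prime ?p" using p by simp
  have "\<forall>s. \<exists>i. \<not> ?p dvd s \<longrightarrow> [s * i = 1] (mod ?p)"
    using cong_solve_coprime_int prime_imp_coprime[OF prime] coprime_commute by metis
  then obtain i where i: "\<And>s. \<not> ?p dvd s \<Longrightarrow> [s * i s = 1] (mod ?p)"
    by metis
  have partner: "\<exists>Q \<in> T. Q \<noteq> P \<and> ?p dvd fst Q - fst P" if P: "P \<in> T" for P
  proof (rule ccontr)
    assume "\<not> ?thesis"
    then have nv: "\<And>Q. Q \<in> T - {P} \<Longrightarrow> \<not> ?p dvd fst Q - fst P" by blast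
    define slope where "slope Q = ((snd Q - snd P) * i (fst Q - fst P)) mod ?p" for Q
    have "inj_on slope (T - {P})"
    proof (rule inj_onI, rule ccontr)
      fix Q R assume Q: "Q \<in> T - {P}" and R: "R \<in> T - {P}" and eq: "slope Q = slope R"
        and "Q \<noteq> R"
      define s t x y where stxy: "s = fst Q - fst P" "t = snd Q - snd P"
        "x = fst R - fst P" "y = snd R - snd P"
      have ii: "[s * i s = 1] (mod ?p)" "[x * i x = 1] (mod ?p)"
        using i nv Q R by (auto simp: stxy)
      have "[t * i s = y * i x] (mod ?p)"
        using eq by (simp add: slope_def stxy cong_def)
      then have "[(s * x) * (t * i s) = (s * x) * (y * i x)] (mod ?p)"
        by (rule cong_mult[OF cong_refl])
      moreover have "[(s * i s) * (x * t) = 1 * (x * t)] (mod ?p)"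
        "[(x * i x) * (s * y) = 1 * (s * y)] (mod ?p)"
        by (intro cong_mult cong_refl ii)+
      ultimately have "[x * t = s * y] (mod ?p)"
        by (simp add: cong_def algebra_simps)
      then have "?p dvd twice_area P Q R"
        by (simp add: cong_iff_dvd_diff dvd_diff_commute twice_area_def stxy algebra_simps)
      with gen[of P Q R] P Q R \<open>Q \<noteq> R\<close> T(1) show False by blast
    qed
    moreover have "slope ` (T - {P}) \<subseteq> {0..<?p}"
      using p prime_gt_0_nat by (auto simp: slope_def)
    ultimately have "card (T - {P}) \<le> card {0..<?p}"
      using card_inj_on_le by blast
    with T P show False by simp
  qed
  define vertical where "vertical P = fst P mod ?p" for P :: "int \<times> int"
  have two: "card {P \<in> T. vertical P = y} = 2" if y: "y \<in> vertical ` T" for y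
  proof -
    obtain P where P: "P \<in> T" "y = vertical P" using y by blast
    obtain Q where Q: "Q \<in> T" "Q \<noteq> P" "?p dvd fst Q - fst P" using partner P by blast
    have "R = P \<or> R = Q" if R: "R \<in> T" "vertical R = y" for R
    proof (rule ccontr)
      assume "\<not> (R = P \<or> R = Q)"
      moreover have "?p dvd fst R - fst P"
        using R P by (simp add: vertical_def mod_eq_dvd_iff)
      with Q(3) have "?p dvd twice_area P Q R"
        by (simp add: twice_area_def)
      ultimately show False
        using gen[of P Q R] P Q R T(1) by blast
    qed
    moreover have "vertical Q = y"
      using Q(3) P(2) by (simp add: vertical_def mod_eq_dvd_iff)
    ultimately have "{P \<in> T. vertical P = y} = {P, Q}"
      using P Q by auto
    then show ?thesis using Q(2) by simp
  qed
  have "card T = (\<Sum>y \<in> vertical ` T. card {P \<in> T. vertical P = y})"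
    using sum.image_gen[OF T(3), of "\<lambda>_. 1 :: nat" vertical] by simp
  also have "\<dots> = (\<Sum>y \<in> vertical ` T. 2)"
    by (rule sum.cong) (simp_all add: two)
  finally have "even (card T)" by simp
  with T(2) p(2) show False by simp
qed

text \<open>If \<open>U\<close> and \<open>V\<close> differ modulo \<open>p\<close>, the points \<open>A, B, C\<close> are on the line that they span.\<close>

lemma twice_area_dvd_if_common_line:
  assumes p: "prime (p :: int)"
    and line: "p dvd twice_area U V A" "p dvd twice_area U V B" "p dvd twice_area U V C"
    and ne: "\<not> (p dvd fst V - fst U \<and> p dvd snd V - snd U)"
  shows "p dvd twice_area A B C"
proof -
  have "(fst V - fst U) * twice_area A B C = (fst B - fst A) * twice_area U V C
      + (fst A - fst C) * twice_area U V B + (fst C - fst B) * twice_area U V A"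
    "(snd V - snd U) * twice_area A B C = (snd B - snd A) * twice_area U V C
      + (snd A - snd C) * twice_area U V B + (snd C - snd B) * twice_area U V A"
    by (simp_all add: twice_area_def algebra_simps)
  then have "p dvd (fst V - fst U) * twice_area A B C" "p dvd (snd V - snd U) * twice_area A B C"
    using line by simp_all
  with ne p show ?thesis
    by (auto simp: prime_dvd_mult_iff)
qed

section \<open>Sets whose collinear triples are the rainbow triples\<close>

text \<open>The bound is the maximum of \<open>p + 3\<close> (one large class and one point, the same modulo \<open>p\<close>, in
  each of the three others) and \<open>8 = 4 * 2\<close> (no class with three points).\<close>

lemma card_le_if_coloured:
  fixes col :: "int \<times> int \<Rightarrow> 'c"
  assumes p: "prime p" "p \<ge> 5" and fin: "finite X"
    and col: "col ` X \<subseteq> K" "finite K" "card K = 4"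
    and rainbow: "\<And>P Q R. P \<in> X \<Longrightarrow> Q \<in> X \<Longrightarrow> R \<in> X \<Longrightarrow> P \<noteq> Q \<Longrightarrow> Q \<noteq> R \<Longrightarrow> P \<noteq> R \<Longrightarrow>
      int p dvd twice_area P Q R \<longleftrightarrow> col P \<noteq> col Q \<and> col Q \<noteq> col R \<and> col P \<noteq> col R"
  shows "card X \<le> p + 3"
proof (rule ccontr)
  let ?p = "int p"
  assume "\<not> card X \<le> p + 3"
  then have big: "card X > p + 3" "card X > 8" using p(2) by simp_all
  have odd: "odd p" using p prime_odd_nat[of p] by simp
  have "\<exists>c \<in> K. card {P \<in> X. col P = c} \<ge> 3"
  proof (rule ccontr)
    assume "\<not> ?thesis"
    then have small: "\<And>c. c \<in> K \<Longrightarrow> card {P \<in> X. col P = c} \<le> 2" by force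
    have "X = (\<Union>c \<in> K. {P \<in> X. col P = c})" using col(1) by blast
    then have "card X \<le> (\<Sum>c \<in> K. card {P \<in> X. col P = c})"
      using card_UN_le[OF col(2), of "\<lambda>c. {P \<in> X. col P = c}"] by simp
    also have "\<dots> \<le> (\<Sum>c \<in> K. 2)"
      by (rule sum_mono) (rule small)
    finally show False using big(2) col(3) by simp
  qed
  then obtain c where c: "c \<in> K" "card {P \<in> X. col P = c} \<ge> 3" by blast
  define C where "C = {P \<in> X. col P = c}"
  obtain A1 A2 A3 where A: "A1 \<in> C" "A2 \<in> C" "A3 \<in> C" "A1 \<noteq> A2" "A2 \<noteq> A3" "A1 \<noteq> A3"
  proof -
    have "3 \<le> card C" using c(2) by (simp add: C_def)
    then obtain T where "T \<subseteq> C" "card T = 3" "finite T"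
      by (rule obtain_subset_with_card_n)
    then show ?thesis using that unfolding card_3_iff by blast
  qed
  have agree: "?p dvd fst V - fst U \<and> ?p dvd snd V - snd U"
    if UV: "U \<in> X - C" "V \<in> X - C" "col U \<noteq> col V" for U V
  proof (rule ccontr)
    assume ne: "\<not> ?thesis"
    have on_line: "?p dvd twice_area U V B" if "B \<in> C" for B
      using UV that by (subst rainbow) (auto simp: C_def)
    have "prime ?p" using p(1) by simp
    then have "?p dvd twice_area A1 A2 A3"
      using twice_area_dvd_if_common_line on_line[OF A(1)] on_line[OF A(2)] on_line[OF A(3)] ne
      by blast
    with rainbow[of A1 A2 A3] A show False by (auto simp: C_def)
  qed
  show False
  proof (cases "\<exists>U \<in> X - C. \<exists>V \<in> X - C. col U \<noteq> col V")
    case False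
    have outside: "col U = c \<or> col V = c \<or> col U = col V" if "U \<in> X" "V \<in> X" for U V
      using False that unfolding C_def by blast
    have "card X \<le> p + 1"
    proof (rule card_le_if_no_three_collinear[OF p(1) odd fin])
      fix P Q R assume PQR: "P \<in> X" "Q \<in> X" "R \<in> X" "P \<noteq> Q" "Q \<noteq> R" "P \<noteq> R"
      have "\<not> (col P \<noteq> col Q \<and> col Q \<noteq> col R \<and> col P \<noteq> col R)"
        using outside[of P Q] outside[of Q R] outside[of P R] PQR(1-3) by metis
      with rainbow[OF PQR] show "\<not> ?p dvd twice_area P Q R" by blast
    qed
    with big show False by simp
  next
    case True
    then obtain U V where UV: "U \<in> X - C" "V \<in> X - C" "col U \<noteq> col V" by blast
    have "inj_on col (X - C)"
    proof (rule inj_onI, rule ccontr)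
      fix P Q assume PQ: "P \<in> X - C" "Q \<in> X - C" "col P = col Q" "P \<noteq> Q"
      obtain W where W: "W \<in> X - C" "col W \<noteq> col P"
        using UV by (cases "col U = col P") auto
      \<comment> \<open>Both agree with \<open>W\<close> modulo \<open>p\<close>, so with each other, and two of three points coincide.\<close>
      have "?p dvd fst P - fst W \<and> ?p dvd snd P - snd W" "?p dvd fst Q - fst W \<and> ?p dvd snd Q - snd W"
        using W(2) PQ(3) by (simp_all only: agree[OF W(1) PQ(1)] agree[OF W(1) PQ(2)] simp_thms)
      then have "?p dvd (fst Q - fst W) - (fst P - fst W)" "?p dvd (snd Q - snd W) - (snd P - snd W)"
        by (blast intro: dvd_diff)+
      then have "?p dvd twice_area P Q A1" by (simp add: twice_area_def)
      moreover have "P \<in> X" "Q \<in> X" "A1 \<in> X" "Q \<noteq> A1" "P \<noteq> A1"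
        using PQ A(1) by (auto simp: C_def)
      ultimately show False
        using rainbow[of P Q A1] PQ(3,4) by blast
    qed
    moreover have "col ` (X - C) \<subseteq> K - {c}" using col(1) by (auto simp: C_def)
    ultimately have "card (X - C) \<le> card (K - {c})"
      using col(2) card_inj_on_le by blast
    then have outside: "card (X - C) \<le> 3" using c(1) col(2,3) by simp
    have finC: "finite C" using fin by (simp add: C_def)
    have "card (insert U C) \<le> p + 1"
    proof (rule card_le_if_no_three_collinear[OF p(1) odd])
      fix P Q R assume PQR: "P \<in> insert U C" "Q \<in> insert U C" "R \<in> insert U C"
        and ne: "P \<noteq> Q" "Q \<noteq> R" "P \<noteq> R"
      have "P \<in> X" "Q \<in> X" "R \<in> X" using PQR UV(1) by (auto simp: C_def)
      moreover have "\<not> (col P \<noteq> col Q \<and> col Q \<noteq> col R \<and> col P \<noteq> col R)"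
        using PQR ne by (auto simp: C_def)
      ultimately show "\<not> ?p dvd twice_area P Q R"
        using rainbow[of P Q R] ne by blast
    qed (use finC in simp)
    then have "card C \<le> p" using finC UV(1) by simp
    moreover have "card X = card C + card (X - C)"
      using fin by (subst card_Diff_subset) (auto simp: C_def card_mono)
    ultimately show False using outside big by simp
  qed
qed

section \<open>Large arcs contain an affine frame\<close>

theorem theorem3p9:
  fixes p :: nat and X :: "(int \<times> int) set"
  assumes "prime p" and "p \<ge> 5"
    and "arc (2 * p) X"
    and "card X > p + 3"
  shows "\<exists>f \<in> carrier (ArcAutoGroup (2 * p)). {(0, 0), (1, 0), (0, 1)} \<subseteq> f ` X"
proof -
  have odd: "odd p" using assms(1,2) prime_odd_nat[of p] by simp
  have sub: "X \<subseteq> torus (2 * p)" using assms(3) by (simp add: arc_def)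
  have fin: "finite X" using assms(4) by (intro card_ge_0_finite) simp
  have same: "\<not> int p dvd twice_area P Q R"
    if "P \<in> X" "Q \<in> X" "R \<in> X" "P \<noteq> Q" "Q \<noteq> R" "P \<noteq> R" "parity_class P = parity_class Q" for P Q R
  proof
    assume "int p dvd twice_area P Q R"
    then have "torus_collinear (2 * p) {P, Q, R}"
      using that sub by (intro collinear_if_same_parity[OF assms(1) odd]) blast+
    moreover have "{P, Q, R} \<subseteq> X" "card {P, Q, R} = 3" using that by auto
    ultimately show False using assms(3) unfolding arc_def by blast
  qed
  have not_same: "parity_class P \<noteq> parity_class Q \<and> parity_class Q \<noteq> parity_class R
      \<and> parity_class P \<noteq> parity_class R"
    if "P \<in> X" "Q \<in> X" "R \<in> X" "P \<noteq> Q" "Q \<noteq> R" "P \<noteq> R" "int p dvd twice_area P Q R" for P Q R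
  proof -
    have "int p dvd twice_area Q R P" "int p dvd twice_area R P Q"
      using that(7) by (simp_all add: twice_area_rotate)
    then show ?thesis
      using same[of P Q R] same[of Q R P] same[of R P Q] that by (auto dest: sym)
  qed
  have "\<exists>P \<in> X. \<exists>Q \<in> X. \<exists>R \<in> X. parity_class P \<noteq> parity_class Q \<and> parity_class Q \<noteq> parity_class R
      \<and> parity_class P \<noteq> parity_class R \<and> \<not> int p dvd twice_area P Q R"
  proof (rule ccontr)
    assume no_frame: "\<not> ?thesis"
    have "card X \<le> p + 3"
    proof (rule card_le_if_coloured[OF assms(1,2) fin])
      show "parity_class ` X \<subseteq> {0, 1} \<times> {0, 1}"
        by (auto simp: parity_class_def)
    next
      fix P Q R assume "P \<in> X" "Q \<in> X" "R \<in> X" "P \<noteq> Q" "Q \<noteq> R" "P \<noteq> R"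
      then show "int p dvd twice_area P Q R \<longleftrightarrow> parity_class P \<noteq> parity_class Q
          \<and> parity_class Q \<noteq> parity_class R \<and> parity_class P \<noteq> parity_class R"
        using not_same[of P Q R] no_frame by blast
    qed simp_all
    with assms(4) show False by simp
  qed
  then obtain P Q R where PQR: "P \<in> X" "Q \<in> X" "R \<in> X"
    and classes: "parity_class P \<noteq> parity_class Q" "parity_class Q \<noteq> parity_class R"
      "parity_class P \<noteq> parity_class R"
    and det: "\<not> int p dvd twice_area P Q R"
    by blast
  have "coprime (twice_area P Q R) (int p)"
    using prime_imp_coprime[of "int p" "twice_area P Q R"] det assms(1)
    by (simp add: coprime_commute)
  then have "coprime (twice_area P Q R) (int (2 * p))"
    using odd_twice_area[OF classes] by simp
  moreover have "P \<in> torus (2 * p)" "Q \<in> torus (2 * p)" "R \<in> torus (2 * p)"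
    using PQR sub by blast+
  ultimately obtain f where f: "f \<in> arc_auto (2 * p)" "f P = (0, 0)" "f Q = (1, 0)" "f R = (0, 1)"
    using frame_to_standard[of "2 * p" P Q R] assms(2) by auto
  then have "{(0, 0), (1, 0), (0, 1)} \<subseteq> f ` X"
    using PQR by (metis empty_subsetI imageI insert_subset)
  moreover have "f \<in> carrier (ArcAutoGroup (2 * p))"
    using f(1) by (simp add: ArcAutoGroup_def)
  ultimately show ?thesis by blast
qed

end
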